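(* Let $\xi>0$. In $(SE(3),\Delta,\mathcal G_\xi)$: (1) Horizontal exponential curves are given by $t\mapsto g_0\,e^{t\sum_{i=3}^5c^iA_i}$ with $\xi^2(c^3)^2+(c^4)^2+(c^5)^2=1$, $g_0\in SE(3)$, and they are precisely the auto-parallel curves, i.e. the horizontal curves (parametrized by sub-Riemannian arclength) with $\overline\nabla_{\dot\gamma}\dot\gamma=0$. (2) Along sub-Riemannian geodesics one has covariantly constant momentum, i.e. $$\overline\nabla^*_{\dot\gamma}\lambda:=\sum_{i=1}^6\Big(\dot\lambda_i+\sum_{j=3}^5\sum_{k=1}^6c^k_{i,j}\lambda_k\dot\gamma^j\Big)\omega^i=0.$$ (3) Setting contravariant components $\lambda^i=\xi^i\lambda_i$ with $\xi^3=\xi^{-2}$, $\xi^4=\xi^5=1$, and $P_{\Delta^*}\lambda=\sum_{i=3}^5\lambda_i\omega^i$, the Hamiltonian system of the Pontryagin Maximum Principle can be written as $$\forall_{i\in\{1,\dots,6\}}:\ \dot\lambda_i+\sum_{j=3}^5\sum_{k=1}^6c^k_{i,j}\lambda_k\lambda^j=0\ \text{ (vertical part)}\qquad\text{and}\qquad\forall_{i\in\{3,4,5\}}:\ \dot\gamma^i=\lambda^i\ \text{ (horizontal part)},$$ which is equivalent to $\overline\nabla^*_{\dot\gamma}\lambda=0$ and $\mathcal G_\xi^{-1}P_{\Delta^*}\lambda=\dot\gamma$.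
   Context: $SE(3)=\mathbb R^3\rtimes SO(3)$ with product $(\mathbf x_1,R_1)(\mathbf x_2,R_2)=(\mathbf x_1+R_1\mathbf x_2,R_1R_2)$ and unit $e=(\mathbf 0,I)$. For $\mathbf a\in\mathbb R^3$ let $\sigma_{\mathbf a}\mathbf y=\mathbf a\times\mathbf y$. Left-invariant frame: $\mathcal A_i|_{(\mathbf x,R)}=(R\mathbf e_i,0)$, $\mathcal A_{3+i}|_{(\mathbf x,R)}=(0,R\sigma_{\mathbf e_i})$, $i=1,2,3$; $A_i=\mathcal A_i|_e$; dual coframe $\omega^1,\dots,\omega^6$; structure constants $[\mathcal A_i,\mathcal A_j]=\sum_{k=1}^6c^k_{i,j}\mathcal A_k$ (nonzero brackets: $[\mathcal A_1,\mathcal A_5]=\mathcal A_3$, $[\mathcal A_1,\mathcal A_6]=-\mathcal A_2$, $[\mathcal A_2,\mathcal A_4]=-\mathcal A_3$, $[\mathcal A_2,\mathcal A_6]=\mathcal A_1$, $[\mathcal A_3,\mathcal A_4]=\mathcal A_2$, $[\mathcal A_3,\mathcal A_5]=-\mathcal A_1$, $[\mathcal A_4,\mathcal A_5]=\mathcal A_6$, $[\mathcal A_4,\mathcal A_6]=-\mathcal A_5$, $[\mathcal A_5,\mathcal A_6]=\mathcal A_4$, and antisymmetry). $\Delta=\mathrm{span}\{\mathcal A_3,\mathcal A_4,\mathcal A_5\}$, $\mathcal G_\xi=\xi^2\omega^3\otimes\omega^3+\omega^4\otimes\omega^4+\omega^5\otimes\omega^5$. A curve $\gamma$ is horizontal if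 $\dot\gamma\in\Delta$; write $\dot\gamma^i=\langle\omega^i|_\gamma,\dot\gamma\rangle$. $A\mapsto e^A$ is the Lie group exponential map. The partial connection $\overline\nabla$ is defined by $$\overline\nabla_{\dot\gamma}\mathcal A=\sum_{k=3}^5\Big(\dot a^k-\sum_{i,j=3}^5c^k_{i,j}\dot\gamma^ia^j\Big)\mathcal A_k,\qquad \dot\gamma=\sum_{i=3}^5\dot\gamma^i\mathcal A_i|_\gamma,\ \mathcal A=\sum_{k=3}^5a^k\mathcal A_k,$$ with $\dot a^k$ the derivative of $a^k$ along $\gamma$. Sub-Riemannian geodesics (horizontal curves whose short arcs minimize length), in sub-Riemannian arclength $t$, are the projections of solutions of the Hamiltonian system of the Pontryagin Maximum Principle, with momentum $\lambda=\sum_{i=1}^6\lambda_i\omega^i|_\gamma$ and Hamiltonian $H=\frac12(\xi^{-2}\lambda_3^2+\lambda_4^2+\lambda_5^2)$: $\dot\gamma=\xi^{-2}\lambda_3\mathcal A_3+\lambda_4\mathcal A_4+\lambda_5\mathcal A_5$; $\dot\lambda_1=-\lambda_3\lambda_5$, $\dot\lambda_2=\lambda_3\lambda_4$, $\dot\lambda_3=\lambda_1\lambda_5-\lambda_2\lambda_4$, $\dot\lambda_4=\xi^{-2}\lambda_2\lambda_3-\lambda_5\lambda_6$, $\dot\lambda_5=\lambda_4\lambda_6-\xi^{-2}\lambda_1\lambda_3$, $\dot\lambda_6=0$. $\mathcal G_\xi^{-1}$ is the map $\Delta^*\to\Delta$ inverse to $\mathcal G_\xi|_\Delta$. *)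

theory Defs
  imports "HOL-Analysis.Analysis"
begin

type_synonym se = "(real^3) \<times> (real^3^3)"

text \<open>SE(3) is regarded as a submanifold of the vector space \<^typ>\<open>se\<close>; tangent vectors at
  its points are elements of the same vector space.\<close>

definition SE3 :: "se set" where
  "SE3 = {(x, R). rotation_matrix R}"

definition se_mult :: "se \<Rightarrow> se \<Rightarrow> se" where
  "se_mult g h = (fst g + snd g *v fst h, snd g ** snd h)"

definition se_one :: se where
  "se_one = (0, mat 1)"

text \<open>In the index type \<open>3\<close> one has \<open>of_nat 3 = 3\<close>, so \<^term>\<open>basis_vec i\<close> is the
  \<open>i\<close>-th standard unit vector for \<open>i = 1, 2, 3\<close>.\<close>

definition basis_vec :: "nat \<Rightarrow> real^3" where
  "basis_vec i = axis (of_nat i) 1"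

definition cross_mat :: "real^3 \<Rightarrow> real^3^3" where
  "cross_mat a = matrix (\<lambda>y. cross3 a y)"

definition frame :: "nat \<Rightarrow> se \<Rightarrow> se" where
  "frame i g = (if i \<le> 3 then (snd g *v basis_vec i, 0)
                else (0, snd g ** cross_mat (basis_vec (i - 3))))"

text \<open>The inverse of \<^const>\<open>cross_mat\<close> on skew matrices, composed with the projection of a
  matrix onto its skew part.\<close>

definition axial :: "real^3^3 \<Rightarrow> real^3" where
  "axial M = vector [(M$3$2 - M$2$3) / 2, (M$1$3 - M$3$1) / 2, (M$2$1 - M$1$2) / 2]"

text \<open>The coframe is written as a family of functionals on the whole ambient space. Only its
  values on tangent vectors of SE(3) matter, and there it is the dual of the frame (lemma
  \<open>coframe_frame\<close>). In particular two combinations of the \<open>coframe i g\<close>, \<open>i = 1..6\<close>, are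
  equal on the ambient space iff they are equal on the tangent space at \<open>g\<close>, and covectors at
  \<open>g\<close> are represented by such combinations.\<close>

definition coframe :: "nat \<Rightarrow> se \<Rightarrow> se \<Rightarrow> real" where
  "coframe i g v = (if i \<le> 3 then (transpose (snd g) *v fst v) $ of_nat i
                    else axial (transpose (snd g) ** snd v) $ of_nat (i - 3))"

text \<open>Lie bracket of vector fields that are given on the ambient vector space, such as the
  (linear) fields \<^term>\<open>frame i\<close>.\<close>

definition lie_bracket :: "(se \<Rightarrow> se) \<Rightarrow> (se \<Rightarrow> se) \<Rightarrow> se \<Rightarrow> se" where
  "lie_bracket X Y g =
     frechet_derivative Y (at g) (X g) - frechet_derivative X (at g) (Y g)"

text \<open>\<open>struct_const k i j\<close> is \<open>c\<^sup>k\<^sub>i\<^sub>j\<close>; see lemmas \<open>lie_bracket_frame\<close>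
  and \<open>lie_bracket_table\<close>.\<close>

definition struct_const :: "nat \<Rightarrow> nat \<Rightarrow> nat \<Rightarrow> real" where
  "struct_const k i j = coframe k se_one (lie_bracket (frame i) (frame j) se_one)"

definition lie_algebra :: "se set" where
  "lie_algebra = span {frame i se_one | i. i \<in> {1..6}}"

text \<open>\<open>e\<^sup>A\<close> is the value at time 1 of the one-parameter subgroup with initial velocity
  \<open>A\<close>; it is only meaningful for \<^term>\<open>A \<in> lie_algebra\<close>.\<close>

definition se_exp :: "se \<Rightarrow> se" where
  "se_exp A = (THE g. \<exists>\<phi> :: real \<Rightarrow> se.
      range \<phi> \<subseteq> SE3 \<and> (\<forall>s t. \<phi> (s + t) = se_mult (\<phi> s) (\<phi> t)) \<and>
      (\<phi> has_vector_derivative A) (at 0) \<and> \<phi> 1 = g)"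

definition Delta :: "se \<Rightarrow> se set" where
  "Delta g = span {frame 3 g, frame 4 g, frame 5 g}"

definition metric :: "real \<Rightarrow> se \<Rightarrow> se \<Rightarrow> se \<Rightarrow> real" where
  "metric \<xi> g v w = \<xi>^2 * coframe 3 g v * coframe 3 g w
                   + coframe 4 g v * coframe 4 g w + coframe 5 g v * coframe 5 g w"

definition metric_inv :: "real \<Rightarrow> se \<Rightarrow> (se \<Rightarrow> real) \<Rightarrow> se" where
  "metric_inv \<xi> g = the_inv_into (Delta g) (\<lambda>v. metric \<xi> g v)"

definition nondeg_interval :: "real set \<Rightarrow> bool" where
  "nondeg_interval I \<longleftrightarrow> is_interval I \<and> interior I \<noteq> {}"

definition velocity :: "real set \<Rightarrow> (real \<Rightarrow> se) \<Rightarrow> real \<Rightarrow> se" where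
  "velocity I \<gamma> t = vector_derivative \<gamma> (at t within I)"

definition vel_comp :: "real set \<Rightarrow> (real \<Rightarrow> se) \<Rightarrow> nat \<Rightarrow> real \<Rightarrow> real" where
  "vel_comp I \<gamma> i t = coframe i (\<gamma> t) (velocity I \<gamma> t)"

definition SE3_curve :: "real set \<Rightarrow> (real \<Rightarrow> se) \<Rightarrow> bool" where
  "SE3_curve I \<gamma> \<longleftrightarrow>
     nondeg_interval I \<and> (\<forall>t\<in>I. \<gamma> t \<in> SE3 \<and> \<gamma> differentiable (at t within I))"

definition horizontal_curve :: "real set \<Rightarrow> (real \<Rightarrow> se) \<Rightarrow> bool" where
  "horizontal_curve I \<gamma> \<longleftrightarrow>
     SE3_curve I \<gamma> \<and> (\<forall>t\<in>I. velocity I \<gamma> t \<in> Delta (\<gamma> t))"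

definition arclength_param :: "real \<Rightarrow> real set \<Rightarrow> (real \<Rightarrow> se) \<Rightarrow> bool" where
  "arclength_param \<xi> I \<gamma> \<longleftrightarrow>
     (\<forall>t\<in>I. metric \<xi> (\<gamma> t) (velocity I \<gamma> t) (velocity I \<gamma> t) = 1)"

definition sr_length :: "real \<Rightarrow> real \<Rightarrow> real \<Rightarrow> (real \<Rightarrow> se) \<Rightarrow> real" where
  "sr_length \<xi> a b \<gamma> = integral {a..b}
     (\<lambda>t. sqrt (metric \<xi> (\<gamma> t) (velocity {a..b} \<gamma> t) (velocity {a..b} \<gamma> t)))"

text \<open>Competitors in the length minimization are Lipschitz curves that are horizontal almost
  everywhere; the Lipschitz condition makes the speed bounded, hence integrable.\<close>

definition admissible_curve :: "real \<Rightarrow> real \<Rightarrow> (real \<Rightarrow> se) \<Rightarrow> bool" where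
  "admissible_curve a b \<eta> \<longleftrightarrow>
     (\<exists>L. lipschitz_on L {a..b} \<eta>) \<and> (\<forall>t\<in>{a..b}. \<eta> t \<in> SE3) \<and>
     (\<exists>N. negligible N \<and> (\<forall>t\<in>{a..b} - N. \<eta> differentiable (at t within {a..b}) \<and>
                                             velocity {a..b} \<eta> t \<in> Delta (\<eta> t)))"

definition minimizes_length :: "real \<Rightarrow> real \<Rightarrow> real \<Rightarrow> (real \<Rightarrow> se) \<Rightarrow> bool" where
  "minimizes_length \<xi> a b \<gamma> \<longleftrightarrow>
     (\<forall>\<eta>. admissible_curve a b \<eta> \<and> \<eta> a = \<gamma> a \<and> \<eta> b = \<gamma> b
          \<longrightarrow> sr_length \<xi> a b \<gamma> \<le> sr_length \<xi> a b \<eta>)"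

definition sr_geodesic :: "real \<Rightarrow> real set \<Rightarrow> (real \<Rightarrow> se) \<Rightarrow> bool" where
  "sr_geodesic \<xi> I \<gamma> \<longleftrightarrow>
     horizontal_curve I \<gamma> \<and> continuous_on I (velocity I \<gamma>) \<and>
     (\<forall>\<tau>\<in>I. \<exists>\<epsilon>>0. \<forall>a\<in>I. \<forall>b\<in>I.
        \<tau> - \<epsilon> < a \<and> a < b \<and> b < \<tau> + \<epsilon> \<longrightarrow> minimizes_length \<xi> a b \<gamma>)"

definition exp_curve :: "real set \<Rightarrow> (real \<Rightarrow> se) \<Rightarrow> bool" where
  "exp_curve I \<gamma> \<longleftrightarrow>
     (\<exists>g0\<in>SE3. \<exists>A\<in>lie_algebra. \<forall>t\<in>I. \<gamma> t = se_mult g0 (se_exp (t *\<^sub>R A)))"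

text \<open>\<open>V\<close> is a field along \<open>\<gamma>\<close> with values in \<open>Delta\<close>; its components are
  \<open>a\<^sup>k = coframe k (\<gamma> t) (V t)\<close>.\<close>

definition partial_conn :: "real set \<Rightarrow> (real \<Rightarrow> se) \<Rightarrow> (real \<Rightarrow> se) \<Rightarrow> real \<Rightarrow> se" where
  "partial_conn I \<gamma> V t =
     (\<Sum>k=3..5.
        (vector_derivative (\<lambda>s. coframe k (\<gamma> s) (V s)) (at t within I)
         - (\<Sum>i=3..5. \<Sum>j=3..5.
              struct_const k i j * vel_comp I \<gamma> i t * coframe j (\<gamma> t) (V t)))
        *\<^sub>R frame k (\<gamma> t))"

definition auto_parallel :: "real set \<Rightarrow> (real \<Rightarrow> se) \<Rightarrow> bool" where
  "auto_parallel I \<gamma> \<longleftrightarrow>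
     (\<forall>t\<in>I. (\<forall>k\<in>{3..5}. vel_comp I \<gamma> k differentiable (at t within I)) \<and>
             partial_conn I \<gamma> (velocity I \<gamma>) t = 0)"

text \<open>A momentum covector field along a curve is given by its components
  \<open>l i t\<close>, \<open>i = 1..6\<close>, with respect to the coframe.\<close>

definition momentum_conn ::
  "real set \<Rightarrow> (real \<Rightarrow> se) \<Rightarrow> (nat \<Rightarrow> real \<Rightarrow> real) \<Rightarrow> real \<Rightarrow> se \<Rightarrow> real" where
  "momentum_conn I \<gamma> l t v =
     (\<Sum>i=1..6.
        (vector_derivative (l i) (at t within I)
         + (\<Sum>j=3..5. \<Sum>k=1..6. struct_const k i j * l k t * vel_comp I \<gamma> j t))
        * coframe i (\<gamma> t) v)"

definition cov_const_momentum ::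
  "real set \<Rightarrow> (real \<Rightarrow> se) \<Rightarrow> (nat \<Rightarrow> real \<Rightarrow> real) \<Rightarrow> bool" where
  "cov_const_momentum I \<gamma> l \<longleftrightarrow> (\<forall>t\<in>I. momentum_conn I \<gamma> l t = (\<lambda>_. 0))"

definition proj_Delta :: "(real \<Rightarrow> se) \<Rightarrow> (nat \<Rightarrow> real \<Rightarrow> real) \<Rightarrow> real \<Rightarrow> se \<Rightarrow> real" where
  "proj_Delta \<gamma> l t v = (\<Sum>i=3..5. l i t * coframe i (\<gamma> t) v)"

definition contra :: "real \<Rightarrow> (nat \<Rightarrow> real \<Rightarrow> real) \<Rightarrow> nat \<Rightarrow> real \<Rightarrow> real" where
  "contra \<xi> l i t = (if i = 3 then inverse (\<xi>^2) else 1) * l i t"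

definition momentum_curve :: "real set \<Rightarrow> (nat \<Rightarrow> real \<Rightarrow> real) \<Rightarrow> bool" where
  "momentum_curve I l \<longleftrightarrow> (\<forall>i\<in>{1..6}. \<forall>t\<in>I. l i differentiable (at t within I))"

text \<open>The canonical equations of \<open>H = (\<xi>\<^sup>-\<^sup>2 \<lambda>\<^sub>3\<^sup>2 + \<lambda>\<^sub>4\<^sup>2 + \<lambda>\<^sub>5\<^sup>2)/2\<close>\<close>

definition pmp_system ::
  "real \<Rightarrow> real set \<Rightarrow> (real \<Rightarrow> se) \<Rightarrow> (nat \<Rightarrow> real \<Rightarrow> real) \<Rightarrow> bool" where
  "pmp_system \<xi> I \<gamma> l \<longleftrightarrow> SE3_curve I \<gamma> \<and> momentum_curve I l \<and>
     (\<forall>t\<in>I.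
        velocity I \<gamma> t = (inverse (\<xi>^2) * l 3 t) *\<^sub>R frame 3 (\<gamma> t)
                          + l 4 t *\<^sub>R frame 4 (\<gamma> t) + l 5 t *\<^sub>R frame 5 (\<gamma> t) \<and>
        vector_derivative (l 1) (at t within I) = - l 3 t * l 5 t \<and>
        vector_derivative (l 2) (at t within I) = l 3 t * l 4 t \<and>
        vector_derivative (l 3) (at t within I) = l 1 t * l 5 t - l 2 t * l 4 t \<and>
        vector_derivative (l 4) (at t within I) = inverse (\<xi>^2) * l 2 t * l 3 t - l 5 t * l 6 t \<and>
        vector_derivative (l 5) (at t within I) = l 4 t * l 6 t - inverse (\<xi>^2) * l 1 t * l 3 t \<and>
        vector_derivative (l 6) (at t within I) = 0)"

definition vertical_part ::
  "real \<Rightarrow> real set \<Rightarrow> (nat \<Rightarrow> real \<Rightarrow> real) \<Rightarrow> bool" where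
  "vertical_part \<xi> I l \<longleftrightarrow>
     (\<forall>t\<in>I. \<forall>i\<in>{1..6}. vector_derivative (l i) (at t within I)
        + (\<Sum>j=3..5. \<Sum>k=1..6. struct_const k i j * l k t * contra \<xi> l j t) = 0)"

definition horizontal_part ::
  "real \<Rightarrow> real set \<Rightarrow> (real \<Rightarrow> se) \<Rightarrow> (nat \<Rightarrow> real \<Rightarrow> real) \<Rightarrow> bool" where
  "horizontal_part \<xi> I \<gamma> l \<longleftrightarrow>
     (\<forall>t\<in>I. \<forall>i\<in>{3..5}. vel_comp I \<gamma> i t = contra \<xi> l i t)"

lemma atLeastAtMost_1_6: "{1..6::nat} = {1, 2, 3, 4, 5, 6}"
  by auto

lemma cross_mat_entries:
  "cross_mat a = vector [vector [0, - a$3, a$2], vector [a$3, 0, - a$1], vector [- a$2, a$1, 0]]"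
  by (simp add: vec_eq_iff forall_3 cross_mat_def matrix_def cross3_def axis_def)

lemma coframe_frame:
  assumes "g \<in> SE3" "i \<in> {1..6}" "j \<in> {1..6}"
  shows "coframe i g (frame j g) = (if i = j then 1 else 0)"
proof -
  define R where "R = snd g"
  have "transpose R ** R = mat 1"
    using assms(1) by (auto simp: R_def SE3_def rotation_matrix_def orthogonal_matrix_def)
  then have inv: "transpose R *v (R *v x) = x" "transpose R ** (R ** M) = M" for x and M :: "real^3^3"
    by (simp_all only: matrix_vector_mul_assoc matrix_mul_assoc matrix_vector_mul_lid matrix_mul_lid)
  have frame_id: "coframe i g (frame j g) =
      (if j \<le> 3 then (if i \<le> 3 then basis_vec j $ of_nat i else 0)
       else (if i \<le> 3 then 0 else axial (cross_mat (basis_vec (j - 3))) $ of_nat (i - 3)))"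
  proof -
    have "axial 0 $ k = 0" for k
      using exhaust_3[of k] by (auto simp: axial_def)
    moreover have "transpose R ** (0 :: real^3^3) = 0"
      by (simp add: matrix_matrix_mult_def vec_eq_iff)
    ultimately show ?thesis
      unfolding coframe_def frame_def R_def[symmetric] by (simp add: inv del: transpose_matrix_vector)
  qed
  show ?thesis
    using assms(2,3) unfolding frame_id atLeastAtMost_1_6
    by (elim insertE emptyE; simp add: cross_mat_entries axial_def basis_vec_def axis_def)
qed

lemma matrix_add_rdistrib': "(A + B) ** C = A ** C + B ** (C :: real^3^3)" for A B :: "real^3^3"
  by (simp add: vec_eq_iff matrix_matrix_mult_def distrib_right sum.distrib)

lemma bounded_linear_frame: "bounded_linear (frame i)"
proof -
  have "linear (frame i)"
    by (rule linearI)
       (auto simp: frame_def matrix_vector_mult_add_rdistrib matrix_add_rdistrib'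
         scaleR_matrix_vector_assoc scalar_matrix_assoc)
  then show ?thesis by (simp add: linear_conv_bounded_linear)
qed

lemma lie_bracket_frame_eq:
  "lie_bracket (frame i) (frame j) g = frame j (frame i g) - frame i (frame j g)"
proof -
  have "frechet_derivative (frame i) (at h) = frame i" for i h
    using bounded_linear_frame[of i] frechet_derivative_at bounded_linear_imp_has_derivative
    by metis
  then show ?thesis by (simp add: lie_bracket_def)
qed

lemma matrix_mult_zero: "(B :: real^3^3) ** 0 = (0 :: real^3^3)" "(0 :: real^3^3) ** B = (0 :: real^3^3)"
  by (simp_all add: matrix_matrix_mult_def vec_eq_iff)

text \<open>The differential of the left translation by \<open>g\<close>, extended to the ambient space.\<close>

definition left_transl :: "se \<Rightarrow> se \<Rightarrow> se" where
  "left_transl g v = (snd g *v fst v, snd g ** snd v)"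

lemma linear_left_transl: "linear (left_transl g)"
  by (rule linearI)
     (auto simp: left_transl_def matrix_vector_right_distrib matrix_add_ldistrib
       matrix_vector_mult_scaleR matrix_scalar_ac scalar_matrix_assoc)

lemma frame_left_invariant: "frame i g = left_transl g (frame i se_one)"
  by (simp add: left_transl_def frame_def se_one_def matrix_mult_zero)

lemma frame_frame_left_invariant:
  "frame j (frame i g) = left_transl g (frame j (frame i se_one))"
  by (simp add: left_transl_def frame_def se_one_def matrix_mult_zero
      matrix_vector_mul_assoc matrix_mul_assoc)

lemma lie_bracket_left_invariant:
  "lie_bracket (frame i) (frame j) g = left_transl g (lie_bracket (frame i) (frame j) se_one)"
  unfolding lie_bracket_frame_eq
  by (simp only: linear_diff[OF linear_left_transl] frame_frame_left_invariant[of _ _ g])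

lemma lie_bracket_one:
  defines "br \<equiv> \<lambda>i j. lie_bracket (frame i) (frame j) se_one" and "A \<equiv> \<lambda>i. frame i se_one"
  shows "br 1 2 = 0" "br 1 3 = 0" "br 2 3 = 0" "br 1 4 = 0" "br 2 5 = 0" "br 3 6 = 0"
    "br 1 5 = A 3" "br 1 6 = - A 2" "br 2 4 = - A 3" "br 2 6 = A 1" "br 3 4 = A 2" "br 3 5 = - A 1"
    "br 4 5 = A 6" "br 4 6 = - A 5" "br 5 6 = A 4"
  unfolding br_def A_def lie_bracket_frame_eq
  by (simp_all add: frame_def se_one_def basis_vec_def axis_def cross_mat_entries vec_eq_iff prod_eq_iff
      forall_3 matrix_vector_mult_def matrix_matrix_mult_def sum_3 mat_def)

lemma lie_bracket_skew:
  "lie_bracket (frame i) (frame j) g = - lie_bracket (frame j) (frame i) g"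
  "lie_bracket (frame i) (frame i) g = 0"
  by (simp_all add: lie_bracket_def)

lemma se_one_in_SE3: "se_one \<in> SE3"
  by (simp add: SE3_def se_one_def rotation_matrix_def orthogonal_matrix_id)

lemma linear_coframe: "linear (coframe i g)"
proof -
  have axial: "axial (M + N) = axial M + axial N" "axial (c *\<^sub>R M) = c *\<^sub>R axial M" for M N c
    by (simp_all add: axial_def vec_eq_iff forall_3 field_simps)
  have "transpose (snd g) ** (c *\<^sub>R M) = c *\<^sub>R (transpose (snd g) ** M)" for c and M :: "real^3^3"
    by (simp add: matrix_scalar_ac scalar_matrix_assoc)
  then show ?thesis
    by (intro linearI)
       (auto simp: coframe_def axial matrix_vector_right_distrib matrix_add_ldistrib
         matrix_vector_mult_scaleR simp del: transpose_matrix_vector)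
qed

lemma lie_bracket_multiple:
  assumes "i \<in> {1..6}" "j \<in> {1..6}"
  shows "\<exists>m\<in>{1..6}. \<exists>c. lie_bracket (frame i) (frame j) se_one = c *\<^sub>R frame m se_one"
proof -
  define P where "P v \<longleftrightarrow> (\<exists>m\<in>{1..6}. \<exists>c. v = c *\<^sub>R frame m se_one)" for v
  have PI: "P v" if "v = c *\<^sub>R frame m se_one" "m \<in> {1..6}" for v c m
    using that by (auto simp: P_def)
  have P: "P 0" "P (frame m se_one)" "P (- frame m se_one)" if "m \<in> {1..6}" for m
    using that PI[of _ 0 m] PI[of _ 1 m] PI[of _ "-1" m] by simp_all
  have Pm: "P 0" "P (frame 1 se_one)" "P (frame 2 se_one)" "P (frame 3 se_one)" "P (frame 4 se_one)"
    "P (frame 6 se_one)" "P (- frame 1 se_one)" "P (- frame 2 se_one)" "P (- frame 3 se_one)"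
    "P (- frame 5 se_one)"
    using P[of 1] P[of 2] P[of 3] P[of 4] P[of 5] P[of 6] by simp_all
  have neg: "P (- v)" if v: "P v" for v
  proof -
    obtain c m where "m \<in> {1..6}" "v = c *\<^sub>R frame m se_one"
      using v unfolding P_def by blast
    then show ?thesis by (intro PI[of _ "- c" m]) simp_all
  qed
  have le: "P (lie_bracket (frame i) (frame j) se_one)"
    if "i \<le> j" "i \<in> {1..6}" "j \<in> {1..6}" for i j
    using that unfolding atLeastAtMost_1_6
    by (elim insertE emptyE; hypsubst;
        (simp only: lie_bracket_one lie_bracket_skew(2) Pm | simp))
  have "P (lie_bracket (frame i) (frame j) se_one)"
  proof (cases "i \<le> j")
    case False
    then show ?thesis
      using neg[OF le[of j i]] assms lie_bracket_skew(1)[of i j] by simp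
  qed (use le assms in simp)
  then show ?thesis unfolding P_def .
qed

lemma lie_bracket_frame:
  assumes "i \<in> {1..6}" "j \<in> {1..6}"
  shows "lie_bracket (frame i) (frame j) g = (\<Sum>k=1..6. struct_const k i j *\<^sub>R frame k g)"
proof -
  obtain m c where m: "m \<in> {1..6}" and c: "lie_bracket (frame i) (frame j) se_one = c *\<^sub>R frame m se_one"
    using lie_bracket_multiple[OF assms] by blast
  have "struct_const k i j = (if k = m then c else 0)" if "k \<in> {1..6}" for k
    using coframe_frame[OF se_one_in_SE3 that m]
    by (simp add: struct_const_def c linear_scale[OF linear_coframe])
  then have "(\<Sum>k=1..6. struct_const k i j *\<^sub>R frame k g)
      = (\<Sum>k=1..6. if k = m then c *\<^sub>R frame m g else 0)"
    by (intro sum.cong) auto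
  also have "\<dots> = c *\<^sub>R frame m g"
    using m by simp
  also have "\<dots> = lie_bracket (frame i) (frame j) g"
    by (simp add: lie_bracket_left_invariant[of i j g] c frame_left_invariant[of m g]
        linear_scale[OF linear_left_transl])
  finally show ?thesis ..
qed

lemma lie_bracket_table:
  "lie_bracket (frame 1) (frame 5) g = frame 3 g"
  "lie_bracket (frame 1) (frame 6) g = - frame 2 g"
  "lie_bracket (frame 2) (frame 4) g = - frame 3 g"
  "lie_bracket (frame 2) (frame 6) g = frame 1 g"
  "lie_bracket (frame 3) (frame 4) g = frame 2 g"
  "lie_bracket (frame 3) (frame 5) g = - frame 1 g"
  "lie_bracket (frame 4) (frame 5) g = frame 6 g"
  "lie_bracket (frame 4) (frame 6) g = - frame 5 g"
  "lie_bracket (frame 5) (frame 6) g = frame 4 g"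
  by (simp_all only: lie_bracket_left_invariant[of _ _ g] lie_bracket_one
      frame_left_invariant[of _ g] linear_neg[OF linear_left_transl])

end

theory Submission
  imports Defs
begin

text \<open>The one-parameter subgroups of \<open>SE(3)\<close> are the explicit screw motions given by Rodrigues' formula,
  and the integral curves of a left-invariant field are exactly their left translates. Hence a
  horizontal curve is an exponential curve iff its velocity has constant components in the
  left-invariant frame. Since all brackets of \<open>A\<^sub>3, A\<^sub>4, A\<^sub>5\<close> lie in the span of \<open>A\<^sub>1, A\<^sub>2, A\<^sub>6\<close>, the
  coefficients of the partial connection vanish, so constant components also characterise
  auto-parallel curves. The momentum equations are the canonical equations with the bracket
  table inserted.\<close>

section \<open>Screw motions and the exponential map\<close>

lemma bounded_bilinear_matrix_matrix_mult:
  "bounded_bilinear (\<lambda>(A :: real^3^3) B :: real^3^3. A ** B)"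
  unfolding bilinear_conv_bounded_bilinear[symmetric] bilinear_def
  by (auto intro!: linearI simp: matrix_add_ldistrib matrix_add_rdistrib' matrix_scalar_ac
      scalar_matrix_assoc)

lemma bounded_bilinear_matrix_vector_mult:
  "bounded_bilinear (\<lambda>(A :: real^3^3) x :: real^3. A *v x)"
  unfolding bilinear_conv_bounded_bilinear[symmetric] bilinear_def
  by (auto intro!: linearI simp: matrix_vector_right_distrib matrix_vector_mult_add_rdistrib
      matrix_vector_mult_scaleR scaleR_matrix_vector_assoc)

lemmas has_vector_derivative_matrix_matrix_mult =
  bounded_bilinear.has_vector_derivative[OF bounded_bilinear_matrix_matrix_mult]

lemmas has_vector_derivative_matrix_const =
  bounded_linear.has_vector_derivative[OF bounded_bilinear.bounded_linear_left[OF
      bounded_bilinear_matrix_vector_mult]]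

lemmas has_vector_derivative_const_matrix =
  bounded_linear.has_vector_derivative[OF bounded_bilinear.bounded_linear_right[OF
      bounded_bilinear_matrix_matrix_mult]]
  bounded_linear.has_vector_derivative[OF bounded_bilinear.bounded_linear_right[OF
      bounded_bilinear_matrix_vector_mult]]

lemma has_vector_derivative_fst_snd:
  assumes "(f has_vector_derivative D) F"
  shows "((\<lambda>t. fst (f t)) has_vector_derivative fst D) F"
    and "((\<lambda>t. snd (f t)) has_vector_derivative snd D) F"
  by (rule bounded_linear.has_vector_derivative[OF bounded_linear_fst assms]
      bounded_linear.has_vector_derivative[OF bounded_linear_snd assms])+

section \<open>Rodrigues' formula: derivative, transpose and inverse\<close>

text \<open>Cayley-Hamilton for a skew matrix: the characteristic polynomial of
  \<open>cross_mat w\<close> is, up to sign, x^3 + |w|^2 x. This keeps products with Rodrigues'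
  formula in the span of \<open>mat 1\<close>, \<open>cross_mat w\<close> and its square.\<close>

lemma cross_mat_cube:
  "cross_mat w ** (cross_mat w ** cross_mat w) = - (norm w)\<^sup>2 *\<^sub>R cross_mat w"
  unfolding power2_norm_eq_inner
  by (simp add: vec_eq_iff forall_3 cross_mat_entries matrix_matrix_mult_def sum_3 inner_vec_def
      algebra_simps power2_eq_square)

lemma transpose_cross_mat: "transpose (cross_mat w) = - cross_mat w"
  by (simp add: vec_eq_iff forall_3 cross_mat_entries transpose_def)

lemma cross_mat_0 [simp]: "cross_mat 0 = 0"
  by (simp add: vec_eq_iff forall_3 cross_mat_entries)

text \<open>Rodrigues' formula and its primitive. For \<open>w = 0\<close> the quotients have the junk value
  \<open>0\<close>, which is harmless because they are multiplied by \<^term>\<open>cross_mat w = 0\<close>.\<close>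

definition rodrigues :: "real^3 \<Rightarrow> real \<Rightarrow> real^3^3" where
  "rodrigues w t = mat 1 + (sin (norm w * t) / norm w) *\<^sub>R cross_mat w
     + ((1 - cos (norm w * t)) / (norm w)\<^sup>2) *\<^sub>R (cross_mat w ** cross_mat w)"

definition rodrigues_primitive :: "real^3 \<Rightarrow> real \<Rightarrow> real^3^3" where
  "rodrigues_primitive w t = t *\<^sub>R mat 1 + ((1 - cos (norm w * t)) / (norm w)\<^sup>2) *\<^sub>R cross_mat w
     + ((norm w * t - sin (norm w * t)) / (norm w)^3) *\<^sub>R (cross_mat w ** cross_mat w)"

lemma rodrigues_0 [simp]: "rodrigues w 0 = mat 1" "rodrigues_primitive w 0 = 0"
  by (simp_all add: rodrigues_def rodrigues_primitive_def)

lemma matrix_mult_scaleR: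
  "(c *\<^sub>R A) ** B = c *\<^sub>R (A ** B)" "A ** (c *\<^sub>R B) = c *\<^sub>R (A ** B)"
  for A B :: "real^3^3"
  using bounded_bilinear.scaleR_left[OF bounded_bilinear_matrix_matrix_mult]
    bounded_bilinear.scaleR_right[OF bounded_bilinear_matrix_matrix_mult] by auto

lemma matrix_mult_minus:
  "(- A) ** B = - (A ** B)" "A ** (- B) = - (A ** B)"
  for A B :: "real^3^3"
  using bounded_bilinear.minus_left[OF bounded_bilinear_matrix_matrix_mult]
    bounded_bilinear.minus_right[OF bounded_bilinear_matrix_matrix_mult] by auto

lemma rodrigues_commute: "cross_mat w ** rodrigues w t = rodrigues w t ** cross_mat w"
  by (simp add: rodrigues_def matrix_add_ldistrib matrix_add_rdistrib' matrix_mult_scaleR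
      matrix_mul_assoc)

text \<open>Multiplying Rodrigues' formula by \<open>cross_mat w\<close> produces a cubic term;
  \<open>cross_mat_cube\<close> turns it into -(1 - cos) times \<open>cross_mat w\<close>, which
  leaves exactly the termwise derivative.\<close>

lemma has_vector_derivative_rodrigues:
  "(rodrigues w has_vector_derivative rodrigues w t ** cross_mat w) (at t within S)"
proof (cases "w = 0")
  case True
  then show ?thesis by (simp add: rodrigues_def[abs_def] matrix_mult_zero)
next
  case False
  then have n: "norm w \<noteq> 0" by simp
  have "(rodrigues w has_vector_derivative
      cos (norm w * t) *\<^sub>R cross_mat w
      + (sin (norm w * t) / norm w) *\<^sub>R (cross_mat w ** cross_mat w)) (at t within S)"
    unfolding rodrigues_def[abs_def] using n
    by (auto intro!: derivative_eq_intros simp: power2_eq_square)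
  also have "cos (norm w * t) *\<^sub>R cross_mat w
      + (sin (norm w * t) / norm w) *\<^sub>R (cross_mat w ** cross_mat w)
      = rodrigues w t ** cross_mat w"
    using n
    by (simp add: rodrigues_def matrix_add_rdistrib' matrix_mult_scaleR matrix_mul_assoc[symmetric]
        cross_mat_cube scaleR_left_diff_distrib)
  finally show ?thesis .
qed

lemma has_vector_derivative_rodrigues_primitive:
  "(rodrigues_primitive w has_vector_derivative rodrigues w t) (at t within S)"
proof (cases "w = 0")
  case True
  then show ?thesis
    by (auto intro!: derivative_eq_intros
        simp: rodrigues_def[abs_def] rodrigues_primitive_def[abs_def] matrix_mult_zero)
next
  case False
  then show ?thesis
    unfolding rodrigues_def rodrigues_primitive_def[abs_def]
    by (auto intro!: derivative_eq_intros simp: power2_eq_square power3_eq_cube divide_simps algebra_simps)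
qed

text \<open>Transposition changes the sign of \<open>cross_mat w\<close> and fixes its square;
  reversing time does the same, since the sine coefficient is odd and the cosine coefficient
  even.\<close>

lemma transpose_rodrigues: "transpose (rodrigues w t) = rodrigues w (- t)"
proof -
  have "transpose (A + B) = transpose A + transpose B" "transpose (c *\<^sub>R A) = c *\<^sub>R transpose A"
    for A B :: "real^3^3" and c
    by (simp_all add: transpose_def vec_eq_iff)
  then show ?thesis
    by (simp add: rodrigues_def transpose_cross_mat matrix_transpose_mul matrix_mult_minus)
qed

lemma has_vector_derivative_rodrigues_uminus:
  "((\<lambda>t. rodrigues w (- t)) has_vector_derivative - (rodrigues w (- t) ** cross_mat w)) (at t within S)"
proof -
  have "((rodrigues w \<circ> uminus) has_vector_derivative - 1 *\<^sub>R (rodrigues w (- t) ** cross_mat w))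
      (at t)"
    by (rule vector_diff_chain_at[OF _ has_vector_derivative_rodrigues])
       (auto intro!: derivative_eq_intros)
  then show ?thesis by (auto simp: o_def intro: has_vector_derivative_at_within)
qed

lemma rodrigues_inverse: "rodrigues w (- t) ** rodrigues w t = mat 1"
proof -
  let ?K = "cross_mat w" and ?Q = "rodrigues w"
  \<comment> \<open>The two terms of the product rule cancel because \<open>cross_mat w\<close>
    commutes with \<open>rodrigues w t\<close>; the constant product is then read off at time
    0.\<close>
  have "((\<lambda>t. ?Q (- t) ** ?Q t) has_vector_derivative 0) (at t within UNIV)" for t
    using has_vector_derivative_matrix_matrix_mult[OF has_vector_derivative_rodrigues_uminus[of w]
        has_vector_derivative_rodrigues[of w]]
    by (simp add: matrix_mult_minus matrix_mul_assoc[symmetric] rodrigues_commute)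
  from has_vector_derivative_zero_constant[OF convex_UNIV this]
  obtain c where c: "\<And>t. ?Q (- t) ** ?Q t = c" by auto
  from c[of 0] c[of t] show ?thesis by simp
qed

section \<open>Screw motions as the one-parameter subgroups\<close>

text \<open>Closed form of the exponential of t(v, \<open>cross_mat w\<close>), as
  \<open>se_exp_eq_screw\<close> confirms: the rotational part solves R' = R
  \<open>cross_mat w\<close>, and the translational part solves x' = R v by integration.\<close>

definition screw :: "real^3 \<Rightarrow> real^3 \<Rightarrow> real \<Rightarrow> se" where
  "screw v w t = (rodrigues_primitive w t *v v, rodrigues w t)"

lemma screw_0: "screw v w 0 = se_one"
  by (simp add: screw_def se_one_def)

lemma se_mult_se_one: "se_mult g se_one = g"
  by (simp add: se_mult_def se_one_def)

lemma se_mult_assoc: "se_mult (se_mult g h) k = se_mult g (se_mult h k)"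
  by (simp add: se_mult_def matrix_vector_right_distrib matrix_vector_mul_assoc matrix_mul_assoc add.assoc)

lemma has_vector_derivative_se_mult:
  assumes "(f has_vector_derivative D) (at t within S)"
  shows "((\<lambda>t. se_mult g (f t)) has_vector_derivative left_transl g D) (at t within S)"
  unfolding se_mult_def left_transl_def
  by (auto intro!: derivative_eq_intros has_vector_derivative_const_matrix
      has_vector_derivative_fst_snd[OF assms])

lemma left_transl_se_mult: "left_transl (se_mult g h) A = left_transl g (left_transl h A)"
  by (simp add: left_transl_def se_mult_def matrix_vector_mul_assoc matrix_mul_assoc)

lemma has_vector_derivative_screw:
  "(screw v w has_vector_derivative left_transl (screw v w t) (v, cross_mat w)) (at t within S)"
  unfolding screw_def[abs_def] left_transl_def
  by (auto intro!: derivative_eq_intros has_vector_derivative_matrix_const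
      has_vector_derivative_rodrigues has_vector_derivative_rodrigues_primitive)

text \<open>An integral curve of the left-invariant field of \<open>(v, cross_mat w)\<close>: its rotational part times
  \<^term>\<open>rodrigues w (- t)\<close> is constant, and then its translational part is determined up to a
  constant by integration.\<close>

lemma integral_curve_eq_screw:
  assumes "convex I"
    and der: "\<And>t. t \<in> I \<Longrightarrow>
      (\<gamma> has_vector_derivative left_transl (\<gamma> t) (v, cross_mat w)) (at t within I)"
  obtains g where "\<And>t. t \<in> I \<Longrightarrow> \<gamma> t = se_mult g (screw v w t)"
proof -
  let ?K = "cross_mat w" and ?Q = "rodrigues w"
  note ders = has_vector_derivative_fst_snd[OF der, unfolded left_transl_def fst_conv snd_conv]
  have "((\<lambda>t. snd (\<gamma> t) ** ?Q (- t)) has_vector_derivative 0) (at t within I)" if "t \<in> I" for t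
    using has_vector_derivative_matrix_matrix_mult[OF ders(2)[OF that]
        has_vector_derivative_rodrigues_uminus, of w]
    by (simp add: matrix_mult_minus matrix_mul_assoc[symmetric] rodrigues_commute)
  from has_vector_derivative_zero_constant[OF \<open>convex I\<close> this]
  obtain R where R: "\<And>t. t \<in> I \<Longrightarrow> snd (\<gamma> t) ** ?Q (- t) = R" by auto
  have snd: "snd (\<gamma> t) = R ** ?Q t" if "t \<in> I" for t
    using R[OF that] rodrigues_inverse[of w t] by (metis matrix_mul_assoc matrix_mul_rid)
  have "((\<lambda>t. fst (\<gamma> t) - R *v (rodrigues_primitive w t *v v)) has_vector_derivative 0)
      (at t within I)" if "t \<in> I" for t
    using has_vector_derivative_diff[OF ders(1)[OF that] has_vector_derivative_const_matrix(2)[OF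
        has_vector_derivative_matrix_const[OF has_vector_derivative_rodrigues_primitive]], of R w v]
    by (simp add: snd[OF that] matrix_vector_mul_assoc)
  from has_vector_derivative_zero_constant[OF \<open>convex I\<close> this]
  obtain x where x: "\<And>t. t \<in> I \<Longrightarrow> fst (\<gamma> t) - R *v (rodrigues_primitive w t *v v) = x" by auto
  have "\<gamma> t = se_mult (x, R) (screw v w t)" if "t \<in> I" for t
    using x[OF that] snd[OF that] by (auto simp: se_mult_def screw_def prod_eq_iff)
  with that show ?thesis by blast
qed

text \<open>The left-invariant field is autonomous, so shifting time by \<open>s\<close> gives
  another integral curve, hence a left translate of the screw motion. Time 0 identifies the
  translating element.\<close>

lemma screw_add: "screw v w (s + t) = se_mult (screw v w s) (screw v w t)"
proof -
  have "((\<lambda>t. screw v w (s + t)) has_vector_derivative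
      left_transl (screw v w (s + t)) (v, cross_mat w)) (at t within UNIV)" for t
  proof -
    have "((screw v w \<circ> (\<lambda>t. s + t)) has_vector_derivative
        1 *\<^sub>R left_transl (screw v w (s + t)) (v, cross_mat w)) (at t)"
      by (rule vector_diff_chain_at[OF _ has_vector_derivative_screw])
         (auto intro!: derivative_eq_intros)
    then show ?thesis by (simp add: o_def)
  qed
  from integral_curve_eq_screw[OF convex_UNIV this]
  obtain g where g: "\<And>t. screw v w (s + t) = se_mult g (screw v w t)" by auto
  from g[of 0] g[of t] show ?thesis by (simp add: screw_0 se_mult_se_one)
qed

text \<open>The determinant of an orthogonal matrix is 1 or -1; here it is also a square, because
  the rotation at time t is the square of the rotation at time t/2.\<close>

lemma screw_in_SE3: "screw v w t \<in> SE3"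
proof -
  have orth: "orthogonal_matrix (rodrigues w t)" for t
    using rodrigues_inverse[of w t]
    by (simp add: orthogonal_matrix transpose_rodrigues)
  have "rodrigues w t = rodrigues w (t/2) ** rodrigues w (t/2)"
    using screw_add[of v w "t/2" "t/2"] by (simp add: screw_def se_mult_def)
  then have "det (rodrigues w t) = (det (rodrigues w (t/2)))\<^sup>2"
    by (simp add: det_mul power2_eq_square)
  with det_orthogonal_matrix[OF orth[of "t/2"]] have "det (rodrigues w t) = 1"
    by auto
  with orth show ?thesis by (simp add: SE3_def screw_def rotation_matrix_def)
qed

lemma se_mult_in_SE3: "g \<in> SE3 \<Longrightarrow> h \<in> SE3 \<Longrightarrow> se_mult g h \<in> SE3"
  by (auto simp: SE3_def se_mult_def rotation_matrix_def orthogonal_matrix_mul det_mul)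

lemma se_mult_left_cancel:
  assumes "g \<in> SE3" "se_mult g h = se_mult g k"
  shows "h = k"
proof -
  have "transpose (snd g) ** snd g = mat 1"
    using assms(1) by (auto simp: SE3_def rotation_matrix_def orthogonal_matrix_def)
  then have "transpose (snd g) *v (snd g *v x) = x" "transpose (snd g) ** (snd g ** M) = M"
    for x and M :: "real^3^3"
    by (simp_all only: matrix_vector_mul_assoc matrix_mul_assoc matrix_vector_mul_lid matrix_mul_lid)
  with assms(2) show ?thesis
    by (simp add: se_mult_def prod_eq_iff) metis
qed

text \<open>The homomorphism law transports the derivative at 0 to every time, so \<phi> is an
  integral curve of the left-invariant field and thus a left translate of the screw motion. The
  translating element is \<phi> 0, an idempotent of the group and therefore the unit.\<close>

lemma one_parameter_subgroup_eq_screw: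
  assumes "range \<phi> \<subseteq> SE3" and hom: "\<And>s t. \<phi> (s + t) = se_mult (\<phi> s) (\<phi> t)"
    and der: "(\<phi> has_vector_derivative (v, cross_mat w)) (at 0)"
  shows "\<phi> = screw v w"
proof -
  have "(\<phi> has_vector_derivative left_transl (\<phi> t) (v, cross_mat w)) (at t within UNIV)" for t
  proof -
    have "((\<lambda>h. se_mult (\<phi> t) (\<phi> h)) has_vector_derivative left_transl (\<phi> t) (v, cross_mat w)) (at 0)"
      by (rule has_vector_derivative_se_mult[OF der])
    then have "((\<lambda>h. \<phi> (t + h)) has_vector_derivative left_transl (\<phi> t) (v, cross_mat w)) (at 0)"
      by (simp add: hom)
    then have "(((\<lambda>h. \<phi> (t + h)) \<circ> (\<lambda>s. s - t)) has_vector_derivative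
        1 *\<^sub>R left_transl (\<phi> t) (v, cross_mat w)) (at t)"
      by (intro vector_diff_chain_at) (auto intro!: derivative_eq_intros)
    then show ?thesis by (simp add: o_def)
  qed
  from integral_curve_eq_screw[OF convex_UNIV this]
  obtain g where g: "\<And>t. \<phi> t = se_mult g (screw v w t)" by auto
  have "se_mult (\<phi> 0) (\<phi> 0) = se_mult (\<phi> 0) se_one"
    using hom[of 0 0] by (simp add: se_mult_se_one)
  then have "\<phi> 0 = se_one"
    using assms(1) se_mult_left_cancel by (metis range_subsetD)
  with g[of 0] have "g = se_one" by (simp add: screw_0 se_mult_se_one)
  with g show ?thesis by (auto simp: se_mult_def se_one_def)
qed

text \<open>The definite description in \<open>se_exp\<close> is resolved by existence, through the
  screw motion run at speed \<open>t\<close>, and by the uniqueness of one-parameter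
  subgroups.\<close>

lemma se_exp_eq_screw: "se_exp (t *\<^sub>R (v, cross_mat w)) = screw v w t"
proof -
  let ?P = "\<lambda>\<phi> :: real \<Rightarrow> se. range \<phi> \<subseteq> SE3 \<and> (\<forall>s t. \<phi> (s + t) = se_mult (\<phi> s) (\<phi> t)) \<and>
      (\<phi> has_vector_derivative t *\<^sub>R (v, cross_mat w)) (at 0)"
  have sc: "t *\<^sub>R (v, cross_mat w) = (t *\<^sub>R v, cross_mat (t *\<^sub>R w))"
    by (simp add: vec_eq_iff forall_3 cross_mat_entries)
  have der: "((\<lambda>s. screw v w (t * s)) has_vector_derivative t *\<^sub>R (v, cross_mat w)) (at 0)"
  proof -
    have "((screw v w \<circ> (\<lambda>s. t * s)) has_vector_derivative t *\<^sub>R (v, cross_mat w)) (at 0)"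
      using has_vector_derivative_screw[of v w 0 UNIV]
      by (intro vector_diff_chain_at) (auto intro!: derivative_eq_intros
          simp: screw_0 se_one_def left_transl_def)
    then show ?thesis by (simp add: o_def)
  qed
  have ex: "?P (\<lambda>s. screw v w (t * s))"
    using der screw_in_SE3 by (auto simp: distrib_left screw_add)
  have uniq: "\<phi> = screw (t *\<^sub>R v) (t *\<^sub>R w)" if "?P \<phi>" for \<phi>
    using that one_parameter_subgroup_eq_screw unfolding sc by blast
  show ?thesis
    unfolding se_exp_def
  proof (rule the_equality)
    show "\<exists>\<phi>. range \<phi> \<subseteq> SE3 \<and> (\<forall>s t. \<phi> (s + t) = se_mult (\<phi> s) (\<phi> t)) \<and>
        (\<phi> has_vector_derivative t *\<^sub>R (v, cross_mat w)) (at 0) \<and> \<phi> 1 = screw v w t"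
      using ex by (intro exI[of _ "\<lambda>s. screw v w (t * s)"]) simp
    show "g = screw v w t" if "\<exists>\<phi>. range \<phi> \<subseteq> SE3 \<and> (\<forall>s t. \<phi> (s + t) = se_mult (\<phi> s) (\<phi> t)) \<and>
        (\<phi> has_vector_derivative t *\<^sub>R (v, cross_mat w)) (at 0) \<and> \<phi> 1 = g" for g
    proof -
      from that obtain \<phi> where \<phi>: "?P \<phi>" "\<phi> 1 = g" by blast
      have "g = screw (t *\<^sub>R v) (t *\<^sub>R w) 1"
        using uniq[OF \<phi>(1)] \<phi>(2) by simp
      \<comment> \<open>Uniqueness applied to the witness itself: scaling the velocities by
        \<open>t\<close> amounts to scaling time by \<open>t\<close>.\<close>
      also have "\<dots> = screw v w (t * 1)"
        using fun_cong[OF uniq[OF ex], of 1] by (rule sym)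
      finally show ?thesis by simp
    qed
  qed
qed


section \<open>Horizontal exponential curves\<close>

text \<open>The left-invariant vector field with constant coefficients \<open>c\<close>; at
  \<open>se_one\<close> it gives the general element of the Lie algebra.\<close>

definition frame_comb :: "(nat \<Rightarrow> real) \<Rightarrow> se \<Rightarrow> se" where
  "frame_comb c g = (\<Sum>i=1..6. c i *\<^sub>R frame i g)"

lemma left_transl_frame_comb: "left_transl g (frame_comb c se_one) = frame_comb c g"
  by (simp add: frame_comb_def linear_sum[OF linear_left_transl] linear_scale[OF linear_left_transl]
      frame_left_invariant[of _ g])

lemma coframe_frame_comb:
  assumes "g \<in> SE3" "j \<in> {1..6}"
  shows "coframe j g (frame_comb c g) = c j"
proof -
  have "coframe j g (frame_comb c g) = (\<Sum>i=1..6. if j = i then c i else 0)"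
    unfolding frame_comb_def linear_sum[OF linear_coframe] linear_scale[OF linear_coframe] real_scaleR_def
    using assms by (intro sum.cong) (simp_all add: coframe_frame)
  then show ?thesis using assms(2) by simp
qed

lemma frame_comb_inject:
  assumes "g \<in> SE3"
  shows "frame_comb c g = frame_comb d g \<longleftrightarrow> (\<forall>i\<in>{1..6}. c i = d i)"
proof
  assume "frame_comb c g = frame_comb d g"
  then show "\<forall>i\<in>{1..6}. c i = d i"
    using coframe_frame_comb[OF assms] by metis
qed (simp add: frame_comb_def)

text \<open>Padding the coefficients with zeros lets horizontal vectors share the lemmas on
  \<open>frame_comb\<close>.\<close>

lemma sum_frame_3_5:
  "(\<Sum>i=3..5. c i *\<^sub>R frame i g) = frame_comb (\<lambda>i. if i \<in> {3..5} then c i else 0) g"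
proof -
  have "(\<Sum>i=3..5. c i *\<^sub>R frame i g) = (\<Sum>i=3..5. (if i \<in> {3..5} then c i else 0) *\<^sub>R frame i g)"
    by (intro sum.cong) auto
  also have "\<dots> = frame_comb (\<lambda>i. if i \<in> {3..5} then c i else 0) g"
    unfolding frame_comb_def by (rule sum.mono_neutral_left) auto
  finally show ?thesis .
qed

lemma atLeastAtMost_3_5: "{3..5::nat} = {3, 4, 5}"
  by auto

lemma mem_Delta: "v \<in> Delta g \<longleftrightarrow> (\<exists>c. v = (\<Sum>i=3..5. c i *\<^sub>R frame i g))"
proof
  assume "v \<in> Delta g"
  then obtain a b c where "v - a *\<^sub>R frame 3 g - b *\<^sub>R frame 4 g - c *\<^sub>R frame 5 g = 0"
    unfolding Delta_def span_breakdown_eq by auto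
  then have "v = (\<Sum>i=3..5. (if i = 3 then a else if i = 4 then b else c) *\<^sub>R frame i g)"
    unfolding atLeastAtMost_3_5 by (simp add: algebra_simps)
  then show "\<exists>c. v = (\<Sum>i=3..5. c i *\<^sub>R frame i g)"
    by (rule exI[of _ "\<lambda>i. if i = 3 then a else if i = 4 then b else c"])
next
  assume "\<exists>c. v = (\<Sum>i=3..5. c i *\<^sub>R frame i g)"
  then show "v \<in> Delta g"
    unfolding Delta_def by (elim exE, simp only:, intro span_sum span_scale span_base)
      (auto simp: atLeastAtMost_3_5)
qed

lemma frame_comb_in_Delta_iff:
  assumes "g \<in> SE3"
  shows "frame_comb c g \<in> Delta g \<longleftrightarrow> c 1 = 0 \<and> c 2 = 0 \<and> c 6 = 0"
proof -
  have "frame_comb c g \<in> Delta g \<longleftrightarrow> (\<exists>d. \<forall>i\<in>{1..6}. c i = (if i \<in> {3..5} then d i else 0))"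
    unfolding mem_Delta sum_frame_3_5 frame_comb_inject[OF assms] ..
  also have "\<dots> \<longleftrightarrow> c 1 = 0 \<and> c 2 = 0 \<and> c 6 = 0"
    unfolding atLeastAtMost_1_6 by auto
  finally show ?thesis .
qed

lemma Delta_expansion:
  assumes "g \<in> SE3" "v \<in> Delta g"
  shows "v = (\<Sum>i=3..5. coframe i g v *\<^sub>R frame i g)"
proof -
  obtain c where v: "v = (\<Sum>i=3..5. c i *\<^sub>R frame i g)"
    using assms(2) unfolding mem_Delta by blast
  then have "coframe i g v = c i" if "i \<in> {3..5}" for i
    using that coframe_frame_comb[OF assms(1), of i] by (simp add: sum_frame_3_5)
  then show ?thesis using v by simp
qed

lemma lie_algebra_frame_comb:
  assumes "A \<in> lie_algebra"
  obtains c where "A = frame_comb c se_one"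
proof -
  have "A \<in> range (\<lambda>c. frame_comb c se_one)"
  proof (rule subsetD[OF span_minimal assms[unfolded lie_algebra_def]])
    show "{frame i se_one | i. i \<in> {1..6}} \<subseteq> range (\<lambda>c. frame_comb c se_one)"
    proof
      fix v
      assume "v \<in> {frame i se_one | i. i \<in> {1..6}}"
      then obtain i where i: "i \<in> {1..6}" "v = frame i se_one" by blast
      then have "frame i se_one = frame_comb (\<lambda>j. if j = i then 1 else 0) se_one"
        by (simp add: frame_comb_def if_distrib[of "\<lambda>x. x *\<^sub>R _"] cong: if_cong)
      with i show "v \<in> range (\<lambda>c. frame_comb c se_one)" by blast
    qed
    show "subspace (range (\<lambda>c. frame_comb c se_one))"
    proof (rule subspaceI)
      have "0 = frame_comb (\<lambda>_. 0) se_one" by (simp add: frame_comb_def)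
      then show "0 \<in> range (\<lambda>c. frame_comb c se_one)" by blast
    next
      fix x y :: se
      assume "x \<in> range (\<lambda>c. frame_comb c se_one)" "y \<in> range (\<lambda>c. frame_comb c se_one)"
      then obtain c d where "x = frame_comb c se_one" "y = frame_comb d se_one" by blast
      then have "x + y = frame_comb (\<lambda>i. c i + d i) se_one"
        by (simp add: frame_comb_def scaleR_add_left sum.distrib)
      then show "x + y \<in> range (\<lambda>c. frame_comb c se_one)" by blast
    next
      fix a :: real and x :: se
      assume "x \<in> range (\<lambda>c. frame_comb c se_one)"
      then obtain c where "x = frame_comb c se_one" by blast
      then have "a *\<^sub>R x = frame_comb (\<lambda>i. a * c i) se_one"
        by (simp add: frame_comb_def scaleR_sum_right)
      then show "a *\<^sub>R x \<in> range (\<lambda>c. frame_comb c se_one)" by blast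
    qed
  qed
  with that show ?thesis by blast
qed

lemma frame_comb_in_lie_algebra: "frame_comb c se_one \<in> lie_algebra"
  unfolding frame_comb_def lie_algebra_def
  by (intro span_sum span_scale span_base) auto

text \<open>Brings a Lie algebra element into the form (v, \<open>cross_mat w\<close>) to which the
  results on screw motions apply.\<close>

lemma frame_comb_se_one:
  "frame_comb c se_one = (vector [c 1, c 2, c 3], cross_mat (vector [c 4, c 5, c 6]))"
  unfolding frame_comb_def atLeastAtMost_1_6
  by (simp add: prod_eq_iff frame_def se_one_def vec_eq_iff forall_3 basis_vec_def
      cross_mat_entries axis_def fst_sum snd_sum)

section \<open>Curves whose velocity has constant frame components\<close>

lemma nondeg_interval_convex: "nondeg_interval I \<Longrightarrow> convex I"
  by (simp add: nondeg_interval_def is_interval_convex)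

lemma nondeg_interval_nonempty: "nondeg_interval I \<Longrightarrow> I \<noteq> {}"
  by (auto simp: nondeg_interval_def)

text \<open>A convex set with nonempty interior lies in the closure of that interior, so each of its
  points is a limit point. This makes derivatives within \<open>I\<close> unique, also at
  endpoints.\<close>

lemma nondeg_interval_at_within:
  assumes "nondeg_interval I" "t \<in> I"
  shows "at t within I \<noteq> bot"
proof -
  have "closure I = closure (interior I)"
    using assms(1) by (intro convex_closure_interior[symmetric] nondeg_interval_convex)
       (auto simp: nondeg_interval_def)
  then have "t \<in> closure (interior I)"
    using assms(2) closure_subset by blast
  then have "t islimpt I"
    using interior_limit_point[of t I] islimpt_subset[OF _ interior_subset, of t I]
    by (auto simp: closure_def)
  then show ?thesis by (simp add: trivial_limit_within)
qed

lemma has_vector_derivative_velocity: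
  assumes "SE3_curve I \<gamma>" "t \<in> I"
  shows "(\<gamma> has_vector_derivative velocity I \<gamma> t) (at t within I)"
  using assms by (simp add: SE3_curve_def velocity_def vector_derivative_works[symmetric])

lemma exponential_curve_velocity:
  assumes I: "nondeg_interval I" and g0: "g0 \<in> SE3"
    and \<gamma>: "\<And>t. t \<in> I \<Longrightarrow> \<gamma> t = se_mult g0 (se_exp (t *\<^sub>R frame_comb c se_one))"
  shows "SE3_curve I \<gamma>" and "\<And>t. t \<in> I \<Longrightarrow> velocity I \<gamma> t = frame_comb c (\<gamma> t)"
proof -
  obtain v w where A: "frame_comb c se_one = (v, cross_mat w)"
    using frame_comb_se_one by blast
  have \<gamma>': "\<gamma> t = se_mult g0 (screw v w t)" if "t \<in> I" for t
    using \<gamma>[OF that] by (simp only: A se_exp_eq_screw)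
  have der: "(\<gamma> has_vector_derivative frame_comb c (\<gamma> t)) (at t within I)" if "t \<in> I" for t
  proof -
    \<comment> \<open>By left invariance, the field at \<gamma> t is the \<open>g0\<close>-translate
      of the field along the screw motion.\<close>
    have "frame_comb c (\<gamma> t) = left_transl g0 (left_transl (screw v w t) (v, cross_mat w))"
      by (simp only: \<gamma>'[OF that] left_transl_frame_comb[of "se_mult _ _", symmetric] A left_transl_se_mult)
    then have "((\<lambda>t. se_mult g0 (screw v w t)) has_vector_derivative frame_comb c (\<gamma> t))
        (at t within I)"
      by (simp only: has_vector_derivative_se_mult[OF has_vector_derivative_screw])
    then show ?thesis
      using has_vector_derivative_transform[of t I \<gamma> "\<lambda>t. se_mult g0 (screw v w t)"] that \<gamma>' by blast
  qed
  show "SE3_curve I \<gamma>"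
    using I der \<gamma>' se_mult_in_SE3[OF g0 screw_in_SE3]
    by (auto simp: SE3_curve_def has_vector_derivative_def differentiable_def)
  show "velocity I \<gamma> t = frame_comb c (\<gamma> t)" if "t \<in> I" for t
    unfolding velocity_def
    by (rule vector_derivative_within[OF nondeg_interval_at_within[OF I that] der[OF that]])
qed

lemma exponential_curve_if_velocity:
  assumes "SE3_curve I \<gamma>" and vel: "\<And>t. t \<in> I \<Longrightarrow> velocity I \<gamma> t = frame_comb c (\<gamma> t)"
  obtains g0 where "g0 \<in> SE3"
    "\<And>t. t \<in> I \<Longrightarrow> \<gamma> t = se_mult g0 (se_exp (t *\<^sub>R frame_comb c se_one))"
proof -
  obtain v w where A: "frame_comb c se_one = (v, cross_mat w)"
    using frame_comb_se_one by blast
  have I: "nondeg_interval I" using assms(1) by (simp add: SE3_curve_def)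
  have "(\<gamma> has_vector_derivative left_transl (\<gamma> t) (v, cross_mat w)) (at t within I)"
    if "t \<in> I" for t
    using has_vector_derivative_velocity[OF assms(1) that]
    by (simp only: vel[OF that] A[symmetric] left_transl_frame_comb)
  from integral_curve_eq_screw[OF nondeg_interval_convex[OF I] this]
  obtain g0 where g0: "\<And>t. t \<in> I \<Longrightarrow> \<gamma> t = se_mult g0 (screw v w t)" by auto
  obtain t where t: "t \<in> I" using nondeg_interval_nonempty[OF I] by blast
  \<comment> \<open>Integration yields \<open>g0\<close> only as an ambient pair. It lies in the
    group because it is recovered from any one point of the curve; time 0 need not belong to
    \<open>I\<close>.\<close>
  have "g0 = se_mult (\<gamma> t) (screw v w (- t))"
    by (simp add: g0[OF t] se_mult_assoc screw_add[symmetric] screw_0 se_mult_se_one)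
  moreover have "\<gamma> t \<in> SE3" using assms(1) t by (simp add: SE3_curve_def)
  ultimately have "g0 \<in> SE3" by (simp add: se_mult_in_SE3 screw_in_SE3)
  with g0 that show ?thesis by (simp only: A se_exp_eq_screw)
qed

section \<open>Structure constants and the coadjoint action\<close>

lemma struct_const_3_5_eq_0:
  assumes "i \<in> {3..5}" "j \<in> {3..5}" "k \<in> {3..5}"
  shows "struct_const k i j = 0"
proof -
  \<comment> \<open>The indices 2, 1 and 6 are those of the brackets [A3,A4], [A3,A5] and [A4,A5],
    up to sign.\<close>
  have z: "coframe k se_one (frame m se_one) = 0" if "m \<in> {1, 2, 6}" for m
    using that assms(3) coframe_frame[OF se_one_in_SE3, of k m] by auto
  have skew: "struct_const k i j = - struct_const k j i" for i j
    unfolding struct_const_def by (subst lie_bracket_skew(1)) (rule linear_neg[OF linear_coframe])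
  have "struct_const k i i = 0" for i
    by (simp add: struct_const_def lie_bracket_skew(2) linear_0[OF linear_coframe])
  moreover have "struct_const k 3 4 = 0" "struct_const k 3 5 = 0" "struct_const k 4 5 = 0"
    unfolding struct_const_def lie_bracket_one
    by (simp_all only: linear_neg[OF linear_coframe] z insert_iff simp_thms neg_0_equal_iff_equal)
  ultimately show ?thesis
    using assms(1,2) skew[of 4 3] skew[of 5 3] skew[of 5 4] unfolding atLeastAtMost_3_5 by auto
qed

text \<open>The sums are the coordinates of the coadjoint action of \<open>x\<close> on the covector \<open>l\<close>, read off
  the bracket table.\<close>

lemma coadjoint_sum:
  fixes l x :: "nat \<Rightarrow> real"
  defines "S \<equiv> \<lambda>i. \<Sum>j=3..5. \<Sum>k=1..6. struct_const k i j * l k * x j"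
  shows "S 1 = l 3 * x 5" "S 2 = - l 3 * x 4" "S 3 = l 2 * x 4 - l 1 * x 5"
    "S 4 = l 6 * x 5 - l 2 * x 3" "S 5 = l 1 * x 3 - l 6 * x 4" "S 6 = l 5 * x 4 - l 4 * x 5"
proof -
  \<comment> \<open>The linear functional with components \<open>l\<close>. Each inner sum over
    \<open>k\<close> is its value on a bracket, so the bracket table can be inserted without
    computing single structure constants.\<close>
  define F where "F v = (\<Sum>k=1..6. coframe k se_one v * l k)" for v
  have S: "S i = F (lie_bracket (frame i) (frame 3) se_one) * x 3
      + F (lie_bracket (frame i) (frame 4) se_one) * x 4
      + F (lie_bracket (frame i) (frame 5) se_one) * x 5" for i
    by (simp add: S_def F_def atLeastAtMost_3_5 struct_const_def sum_distrib_right)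
  have F_frame: "F (frame m se_one) = l m" if "m \<in> {1..6}" for m
  proof -
    have "F (frame m se_one) = (\<Sum>k=1..6. if k = m then l k else 0)"
      unfolding F_def using that by (intro sum.cong) (simp_all add: coframe_frame[OF se_one_in_SE3])
    then show ?thesis using that by simp
  qed
  have F0: "F 0 = 0" and Fneg: "F (- v) = - F v" for v
    by (simp_all add: F_def linear_0[OF linear_coframe] linear_neg[OF linear_coframe] sum_negf)
  have skew: "F (lie_bracket (frame i) (frame j) se_one) = - F (lie_bracket (frame j) (frame i) se_one)"
    for i j
    by (subst lie_bracket_skew(1)) (rule Fneg)
  \<comment> \<open>The table lists only brackets with increasing indices; these instances reduce
    the remaining ones whose second index is 3, 4 or 5.\<close>
  note skews = skew[of 4 3] skew[of 5 3] skew[of 5 4] skew[of 6 3] skew[of 6 4] skew[of 6 5]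
  note br = S skews lie_bracket_one lie_bracket_skew(2) F0 Fneg
  have Fl: "F (frame 1 se_one) = l 1" "F (frame 2 se_one) = l 2" "F (frame 3 se_one) = l 3"
    "F (frame 4 se_one) = l 4" "F (frame 5 se_one) = l 5" "F (frame 6 se_one) = l 6"
    by (simp_all add: F_frame)
  show "S 1 = l 3 * x 5" "S 2 = - l 3 * x 4" "S 3 = l 2 * x 4 - l 1 * x 5"
    "S 4 = l 6 * x 5 - l 2 * x 3" "S 5 = l 1 * x 3 - l 6 * x 4" "S 6 = l 5 * x 4 - l 4 * x 5"
    unfolding br Fl by simp_all
qed

section \<open>Characterisations of horizontal exponential curves\<close>

lemma metric_frame_comb:
  assumes "g \<in> SE3"
  shows "metric \<xi> g (frame_comb c g) (frame_comb c g) = \<xi>\<^sup>2 * (c 3)\<^sup>2 + (c 4)\<^sup>2 + (c 5)\<^sup>2"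
  by (simp add: metric_def coframe_frame_comb[OF assms] power2_eq_square)

lemma horizontal_exp_curve_iff:
  assumes I: "nondeg_interval I"
  shows "horizontal_curve I \<gamma> \<and> arclength_param \<xi> I \<gamma> \<and> exp_curve I \<gamma> \<longleftrightarrow>
    (\<exists>g0\<in>SE3. \<exists>c. \<xi>\<^sup>2 * (c 3)\<^sup>2 + (c 4)\<^sup>2 + (c 5)\<^sup>2 = 1 \<and>
      (\<forall>t\<in>I. \<gamma> t = se_mult g0 (se_exp (t *\<^sub>R (\<Sum>i=3..5. c i *\<^sub>R frame i se_one)))))"
  (is "?L \<longleftrightarrow> ?R")
proof
  assume L: ?L
  then obtain g0 A where g0: "g0 \<in> SE3" and A: "A \<in> lie_algebra"
    and \<gamma>: "\<forall>t\<in>I. \<gamma> t = se_mult g0 (se_exp (t *\<^sub>R A))"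
    unfolding exp_curve_def by blast
  obtain c where c: "A = frame_comb c se_one" using lie_algebra_frame_comb[OF A] .
  have curve: "SE3_curve I \<gamma>" and vel: "\<And>t. t \<in> I \<Longrightarrow> velocity I \<gamma> t = frame_comb c (\<gamma> t)"
    using exponential_curve_velocity[OF I g0, of \<gamma> c] \<gamma> c by auto
  \<comment> \<open>Since \<open>c\<close> is independent of time, horizontality and unit speed at a
    single point determine the constraints on it.\<close>
  obtain t where t: "t \<in> I" using nondeg_interval_nonempty[OF I] by blast
  have g: "\<gamma> t \<in> SE3" using curve t by (simp add: SE3_curve_def)
  have "frame_comb c (\<gamma> t) \<in> Delta (\<gamma> t)"
    using L t unfolding vel[OF t, symmetric] horizontal_curve_def by blast
  then have "c 1 = 0" "c 2 = 0" "c 6 = 0"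
    unfolding frame_comb_in_Delta_iff[OF g] by blast+
  then have "A = (\<Sum>i=3..5. c i *\<^sub>R frame i se_one)"
    unfolding c sum_frame_3_5 frame_comb_inject[OF se_one_in_SE3] atLeastAtMost_1_6 by auto
  moreover have "\<xi>\<^sup>2 * (c 3)\<^sup>2 + (c 4)\<^sup>2 + (c 5)\<^sup>2 = 1"
    using L t unfolding arclength_param_def metric_frame_comb[OF g, symmetric] vel[OF t, symmetric]
    by blast
  ultimately show ?R using g0 \<gamma> by blast
next
  assume ?R
  then obtain g0 c where g0: "g0 \<in> SE3" and c: "\<xi>\<^sup>2 * (c 3)\<^sup>2 + (c 4)\<^sup>2 + (c 5)\<^sup>2 = 1"
    and \<gamma>: "\<forall>t\<in>I. \<gamma> t = se_mult g0 (se_exp (t *\<^sub>R (\<Sum>i=3..5. c i *\<^sub>R frame i se_one)))"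
    by blast
  define d where "d i = (if i \<in> {3..5} then c i else 0)" for i :: nat
  have sum: "(\<Sum>i=3..5. c i *\<^sub>R frame i g) = frame_comb d g" for g
    unfolding d_def by (rule sum_frame_3_5)
  have curve: "SE3_curve I \<gamma>" and vel: "\<And>t. t \<in> I \<Longrightarrow> velocity I \<gamma> t = frame_comb d (\<gamma> t)"
    using exponential_curve_velocity[OF I g0, of \<gamma> d] \<gamma> by (auto simp: sum)
  have g: "\<gamma> t \<in> SE3" if "t \<in> I" for t using curve that by (simp add: SE3_curve_def)
  have "horizontal_curve I \<gamma>"
    using curve by (simp add: horizontal_curve_def vel frame_comb_in_Delta_iff[OF g] d_def)
  moreover have "arclength_param \<xi> I \<gamma>"
    using c by (simp add: arclength_param_def vel metric_frame_comb[OF g] d_def)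
  moreover have "exp_curve I \<gamma>"
    using g0 \<gamma> frame_comb_in_lie_algebra unfolding exp_curve_def sum by blast
  ultimately show ?L by blast
qed

lemma horizontal_velocity_expansion:
  assumes "horizontal_curve I \<gamma>" "t \<in> I"
  shows "velocity I \<gamma> t = (\<Sum>i=3..5. vel_comp I \<gamma> i t *\<^sub>R frame i (\<gamma> t))"
  unfolding vel_comp_def
  using assms by (intro Delta_expansion) (auto simp: horizontal_curve_def SE3_curve_def)

text \<open>No bracket of two fields of the distribution has a component in the distribution, so the
  connection coefficients vanish.\<close>

lemma partial_conn_eq:
  "partial_conn I \<gamma> V t =
    (\<Sum>k=3..5. vector_derivative (\<lambda>s. coframe k (\<gamma> s) (V s)) (at t within I) *\<^sub>R frame k (\<gamma> t))"
proof -
  have "(\<Sum>i=3..5. \<Sum>j=3..5. struct_const k i j * vel_comp I \<gamma> i t * coframe j (\<gamma> t) (V t)) = 0"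
    if "k \<in> {3..5}" for k
    using that by (intro sum.neutral ballI) (simp add: struct_const_3_5_eq_0)
  then show ?thesis
    unfolding partial_conn_def by (intro sum.cong) simp_all
qed

lemma vel_comp_abs: "vel_comp I \<gamma> k = (\<lambda>t. coframe k (\<gamma> t) (velocity I \<gamma> t))"
  by (rule ext) (rule vel_comp_def)

text \<open>With vanishing connection coefficients, the equation says that the derivatives of the
  components vanish, the frame being linearly independent; on a convex set this means that they are
  constant.\<close>

lemma auto_parallel_iff_constant_components:
  assumes "SE3_curve I \<gamma>"
  shows "auto_parallel I \<gamma> \<longleftrightarrow> (\<exists>c. \<forall>k\<in>{3..5}. \<forall>t\<in>I. vel_comp I \<gamma> k t = c k)"
    (is "?L \<longleftrightarrow> ?R")
proof
  have I: "nondeg_interval I" using assms by (simp add: SE3_curve_def)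
  {
    assume L: ?L
    have "\<exists>c. \<forall>t\<in>I. vel_comp I \<gamma> k t = c" if k: "k \<in> {3..5}" for k
    proof -
      have "(vel_comp I \<gamma> k has_vector_derivative 0) (at t within I)" if t: "t \<in> I" for t
      proof -
        let ?d = "\<lambda>k. vector_derivative (vel_comp I \<gamma> k) (at t within I)"
        have g: "\<gamma> t \<in> SE3" using assms t by (simp add: SE3_curve_def)
        have "(\<Sum>k=3..5. ?d k *\<^sub>R frame k (\<gamma> t)) = 0"
          using L t by (simp add: auto_parallel_def partial_conn_eq vel_comp_abs)
        then have "coframe k (\<gamma> t) (\<Sum>k=3..5. ?d k *\<^sub>R frame k (\<gamma> t)) = 0"
          by (simp add: linear_0[OF linear_coframe])
        then have "?d k = 0"
          using k by (simp add: sum_frame_3_5 coframe_frame_comb[OF g])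
        \<comment> \<open>The value 0 of \<open>vector_derivative\<close> is a statement about an
          actual derivative only where one exists.\<close>
        moreover have "vel_comp I \<gamma> k differentiable (at t within I)"
          using L t k unfolding auto_parallel_def by blast
        ultimately show ?thesis by (simp add: vector_derivative_works)
      qed
      from has_vector_derivative_zero_constant[OF nondeg_interval_convex[OF I] this]
      show ?thesis by blast
    qed
    then show ?R by metis
  next
    assume ?R
    then obtain c where c: "\<And>k t. k \<in> {3..5} \<Longrightarrow> t \<in> I \<Longrightarrow> vel_comp I \<gamma> k t = c k" by blast
    have der: "(vel_comp I \<gamma> k has_vector_derivative 0) (at t within I)"
      if "k \<in> {3..5}" "t \<in> I" for k t
      using has_vector_derivative_transform[of t I "vel_comp I \<gamma> k" "\<lambda>_. c k" 0] c that by simp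
    then have "vector_derivative (vel_comp I \<gamma> k) (at t within I) = 0"
      if "k \<in> {3..5}" "t \<in> I" for k t
      using vector_derivative_within nondeg_interval_at_within[OF I] that by blast
    then show ?L
      unfolding auto_parallel_def partial_conn_eq vel_comp_abs[symmetric]
      using differentiableI_vector[OF der] by (auto intro!: sum.neutral)
  }
qed

text \<open>Both properties amount to constancy of the components 3, 4, 5 of the velocity, and for a
  horizontal curve these determine the velocity.\<close>

lemma horizontal_exp_curve_iff_auto_parallel:
  assumes I: "nondeg_interval I"
  shows "horizontal_curve I \<gamma> \<and> exp_curve I \<gamma> \<longleftrightarrow> horizontal_curve I \<gamma> \<and> auto_parallel I \<gamma>"
proof (intro conj_cong refl iffI)
  assume hor: "horizontal_curve I \<gamma>"
  then have curve: "SE3_curve I \<gamma>" by (simp add: horizontal_curve_def)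
  {
    assume "exp_curve I \<gamma>"
    then obtain g0 c where g0: "g0 \<in> SE3"
      and \<gamma>: "\<And>t. t \<in> I \<Longrightarrow> \<gamma> t = se_mult g0 (se_exp (t *\<^sub>R frame_comb c se_one))"
      unfolding exp_curve_def by (metis lie_algebra_frame_comb)
    have "vel_comp I \<gamma> k t = c k" if "k \<in> {3..5}" "t \<in> I" for k t
      using exponential_curve_velocity(2)[OF I g0 \<gamma> that(2)] curve that
      by (simp add: vel_comp_def coframe_frame_comb SE3_curve_def)
    then show "auto_parallel I \<gamma>"
      unfolding auto_parallel_iff_constant_components[OF curve] by blast
  next
    assume "auto_parallel I \<gamma>"
    then obtain c where c: "\<And>k t. k \<in> {3..5} \<Longrightarrow> t \<in> I \<Longrightarrow> vel_comp I \<gamma> k t = c k"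
      unfolding auto_parallel_iff_constant_components[OF curve] by blast
    have "velocity I \<gamma> t = frame_comb (\<lambda>i. if i \<in> {3..5} then c i else 0) (\<gamma> t)" if "t \<in> I" for t
      unfolding sum_frame_3_5[symmetric] horizontal_velocity_expansion[OF hor that]
      using c that by (intro sum.cong) auto
    then show "exp_curve I \<gamma>"
      using exponential_curve_if_velocity[OF curve] frame_comb_in_lie_algebra
      unfolding exp_curve_def by metis
  }
qed

section \<open>Momentum equations\<close>

text \<open>One vector equation carries both horizontality and the horizontal part; the canonical
  equations and the inverse metric each produce it in this form.\<close>

lemma velocity_eq_contra_iff:
  assumes "SE3_curve I \<gamma>"
  shows "(\<forall>t\<in>I. velocity I \<gamma> t = (\<Sum>i=3..5. contra \<xi> l i t *\<^sub>R frame i (\<gamma> t))) \<longleftrightarrow>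
    horizontal_curve I \<gamma> \<and> horizontal_part \<xi> I \<gamma> l" (is "?L \<longleftrightarrow> ?R")
proof
  assume L: ?L
  have "vel_comp I \<gamma> i t = contra \<xi> l i t" if "i \<in> {3..5}" "t \<in> I" for i t
  proof -
    have "\<gamma> t \<in> SE3" using assms that by (simp add: SE3_curve_def)
    then show ?thesis
      unfolding vel_comp_def L[rule_format, OF that(2)] sum_frame_3_5
      using that by (simp add: coframe_frame_comb)
  qed
  moreover have "velocity I \<gamma> t \<in> Delta (\<gamma> t)" if "t \<in> I" for t
    unfolding mem_Delta using L that by (intro exI[of _ "\<lambda>i. contra \<xi> l i t"]) simp
  ultimately show ?R
    using assms by (simp add: horizontal_part_def horizontal_curve_def)
next
  assume R: ?R
  show ?L
  proof
    fix t
    assume t: "t \<in> I"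
    show "velocity I \<gamma> t = (\<Sum>i=3..5. contra \<xi> l i t *\<^sub>R frame i (\<gamma> t))"
      unfolding horizontal_velocity_expansion[OF conjunct1[OF R] t]
      using R t by (intro sum.cong) (auto simp: horizontal_part_def)
  qed
qed

text \<open>The inverse is meaningful because the metric is nondegenerate on the distribution:
  testing against the frame vectors 3, 4, 5 recovers the components, the first after division by
  \<xi>^2.\<close>

lemma metric_inv_metric:
  assumes g: "g \<in> SE3" and v: "v \<in> Delta g" and "\<xi> > 0"
  shows "metric_inv \<xi> g (metric \<xi> g v) = v"
  unfolding metric_inv_def
proof (rule the_inv_into_f_f[OF inj_onI v])
  fix x y
  assume x: "x \<in> Delta g" and y: "y \<in> Delta g" and eq: "metric \<xi> g x = metric \<xi> g y"
  have "coframe i g x = coframe i g y" if "i \<in> {3..5}" for i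
    using fun_cong[OF eq, of "frame i g"] that \<open>\<xi> > 0\<close> unfolding atLeastAtMost_3_5
    by (auto simp: metric_def coframe_frame[OF g])
  then have "(\<Sum>i=3..5. coframe i g x *\<^sub>R frame i g) = (\<Sum>i=3..5. coframe i g y *\<^sub>R frame i g)"
    by (intro sum.cong) simp_all
  then show "x = y"
    by (simp only: Delta_expansion[OF g x, symmetric] Delta_expansion[OF g y, symmetric])
qed

lemma metric_inv_proj_Delta:
  assumes g: "\<gamma> t \<in> SE3" and "\<xi> > 0"
  shows "metric_inv \<xi> (\<gamma> t) (proj_Delta \<gamma> l t) = (\<Sum>i=3..5. contra \<xi> l i t *\<^sub>R frame i (\<gamma> t))"
    (is "_ = ?v")
proof -
  have "coframe i (\<gamma> t) ?v = contra \<xi> l i t" if "i \<in> {3..5}" for i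
    using that by (simp add: sum_frame_3_5 coframe_frame_comb[OF g])
  then have "metric \<xi> (\<gamma> t) ?v = proj_Delta \<gamma> l t"
    using \<open>\<xi> > 0\<close> unfolding metric_def proj_Delta_def
    by (intro ext) (simp add: atLeastAtMost_3_5 contra_def)
  moreover have "?v \<in> Delta (\<gamma> t)"
    unfolding mem_Delta by (rule exI[of _ "\<lambda>i. contra \<xi> l i t"]) simp
  ultimately show ?thesis using metric_inv_metric[OF g _ \<open>\<xi> > 0\<close>, of ?v] by (simp only:)
qed

section \<open>Covariantly constant momentum and the canonical equations\<close>

lemma cov_const_momentum_iff:
  assumes "SE3_curve I \<gamma>"
  shows "cov_const_momentum I \<gamma> l \<longleftrightarrow>
    (\<forall>t\<in>I. \<forall>i\<in>{1..6}. vector_derivative (l i) (at t within I)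
       + (\<Sum>j=3..5. \<Sum>k=1..6. struct_const k i j * l k t * vel_comp I \<gamma> j t) = 0)"
proof -
  \<comment> \<open>Linear independence of the coframe, obtained by evaluating on the dual frame
    vectors.\<close>
  have zero: "(\<lambda>v. \<Sum>i=1..6. a i * coframe i g v) = (\<lambda>_. 0) \<longleftrightarrow> (\<forall>i\<in>{1..6}. a i = 0)"
    if g: "g \<in> SE3" for a and g
  proof
    assume eq: "(\<lambda>v. \<Sum>i=1..6. a i * coframe i g v) = (\<lambda>_. 0)"
    show "\<forall>i\<in>{1..6}. a i = 0"
    proof
      fix j :: nat
      assume j: "j \<in> {1..6}"
      have "(\<Sum>i=1..6. a i * coframe i g (frame j g)) = (\<Sum>i=1..6. if i = j then a i else 0)"
        using j by (intro sum.cong) (simp_all add: coframe_frame[OF g])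
      then show "a j = 0" using fun_cong[OF eq, of "frame j g"] j by simp
    qed
  qed simp
  show ?thesis
    unfolding cov_const_momentum_def momentum_conn_def
    by (intro ball_cong refl zero) (use assms in \<open>simp add: SE3_curve_def\<close>)
qed

lemma cov_const_momentum_iff_vertical_part:
  assumes "SE3_curve I \<gamma>" "horizontal_part \<xi> I \<gamma> l"
  shows "cov_const_momentum I \<gamma> l \<longleftrightarrow> vertical_part \<xi> I l"
proof -
  have "(\<Sum>j=3..5. \<Sum>k=1..6. struct_const k i j * l k t * vel_comp I \<gamma> j t)
      = (\<Sum>j=3..5. \<Sum>k=1..6. struct_const k i j * l k t * contra \<xi> l j t)" if "t \<in> I" for i t
    using assms(2) that by (intro sum.cong) (auto simp: horizontal_part_def)
  then show ?thesis
    unfolding cov_const_momentum_iff[OF assms(1)] vertical_part_def by simp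
qed

lemma pmp_system_iff:
  assumes "SE3_curve I \<gamma>" "momentum_curve I l"
  shows "pmp_system \<xi> I \<gamma> l \<longleftrightarrow>
    horizontal_curve I \<gamma> \<and> vertical_part \<xi> I l \<and> horizontal_part \<xi> I \<gamma> l"
proof -
  let ?d = "\<lambda>i t. vector_derivative (l i) (at t within I)"
  have vert: "vertical_part \<xi> I l \<longleftrightarrow> (\<forall>t\<in>I.
        ?d 1 t = - l 3 t * l 5 t \<and> ?d 2 t = l 3 t * l 4 t \<and>
        ?d 3 t = l 1 t * l 5 t - l 2 t * l 4 t \<and>
        ?d 4 t = inverse (\<xi>\<^sup>2) * l 2 t * l 3 t - l 5 t * l 6 t \<and>
        ?d 5 t = l 4 t * l 6 t - inverse (\<xi>\<^sup>2) * l 1 t * l 3 t \<and>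
        ?d 6 t = 0)"
    unfolding vertical_part_def
  proof (intro ball_cong refl)
    fix t
    show "(\<forall>i\<in>{1..6}. ?d i t
          + (\<Sum>j=3..5. \<Sum>k=1..6. struct_const k i j * l k t * contra \<xi> l j t) = 0) \<longleftrightarrow>
        ?d 1 t = - l 3 t * l 5 t \<and> ?d 2 t = l 3 t * l 4 t \<and>
        ?d 3 t = l 1 t * l 5 t - l 2 t * l 4 t \<and>
        ?d 4 t = inverse (\<xi>\<^sup>2) * l 2 t * l 3 t - l 5 t * l 6 t \<and>
        ?d 5 t = l 4 t * l 6 t - inverse (\<xi>\<^sup>2) * l 1 t * l 3 t \<and> ?d 6 t = 0"
      \<comment> \<open>The index set is expanded only under the quantifier, so that the inner sums
        over \<open>k\<close> keep the shape of \<open>coadjoint_sum\<close>. The sixth sum cancels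
        because the metric weights the directions 4 and 5 equally.\<close>
      unfolding atLeastAtMost_1_6[THEN arg_cong[where f = "\<lambda>A. Ball A _"]] ball_simps
        coadjoint_sum[of "\<lambda>k. l k t" "\<lambda>j. contra \<xi> l j t"]
      by (auto simp: contra_def algebra_simps add_eq_0_iff)
  qed
  have vel: "(inverse (\<xi>\<^sup>2) * l 3 t) *\<^sub>R frame 3 (\<gamma> t) + l 4 t *\<^sub>R frame 4 (\<gamma> t) + l 5 t *\<^sub>R frame 5 (\<gamma> t)
      = (\<Sum>i=3..5. contra \<xi> l i t *\<^sub>R frame i (\<gamma> t))" for t
    by (simp add: atLeastAtMost_3_5 contra_def)
  show ?thesis
    using assms velocity_eq_contra_iff[OF assms(1), of \<xi> l] vert
    unfolding pmp_system_def vel by blast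
qed

lemma pmp_system_cov_const_momentum:
  assumes "pmp_system \<xi> I \<gamma> l"
  shows "cov_const_momentum I \<gamma> l"
proof -
  have "SE3_curve I \<gamma>" "momentum_curve I l"
    using assms by (simp_all add: pmp_system_def)
  then show ?thesis
    using assms pmp_system_iff cov_const_momentum_iff_vertical_part by blast
qed

text \<open>In the claim on geodesics, the maximum principle appears as the premise that every
  geodesic in arclength carries a momentum solving the canonical system.\<close>

theorem theorem3:
  fixes \<xi> :: real
  assumes "\<xi> > 0"
  shows
    "(\<forall>I \<gamma>. nondeg_interval I \<longrightarrow>
        ((horizontal_curve I \<gamma> \<and> arclength_param \<xi> I \<gamma> \<and> exp_curve I \<gamma>)
          \<longleftrightarrow> (\<exists>g0\<in>SE3. \<exists>c :: nat \<Rightarrow> real. \<xi>^2 * (c 3)^2 + (c 4)^2 + (c 5)^2 = 1 \<and>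
                (\<forall>t\<in>I. \<gamma> t = se_mult g0 (se_exp (t *\<^sub>R (\<Sum>i=3..5. c i *\<^sub>R frame i se_one))))))
        \<and>
        ((horizontal_curve I \<gamma> \<and> arclength_param \<xi> I \<gamma> \<and> exp_curve I \<gamma>)
          \<longleftrightarrow> (horizontal_curve I \<gamma> \<and> arclength_param \<xi> I \<gamma> \<and> auto_parallel I \<gamma>)))
     \<and>
     ((\<forall>I \<gamma> l. pmp_system \<xi> I \<gamma> l \<longrightarrow> cov_const_momentum I \<gamma> l) \<and>
      ((\<forall>I \<gamma>. sr_geodesic \<xi> I \<gamma> \<and> arclength_param \<xi> I \<gamma> \<longrightarrow> (\<exists>l. pmp_system \<xi> I \<gamma> l)) \<longrightarrow>
       (\<forall>I \<gamma>. sr_geodesic \<xi> I \<gamma> \<and> arclength_param \<xi> I \<gamma> \<longrightarrow>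
          (\<exists>l. pmp_system \<xi> I \<gamma> l \<and> cov_const_momentum I \<gamma> l))))
     \<and>
     (\<forall>I \<gamma> l. SE3_curve I \<gamma> \<and> momentum_curve I l \<longrightarrow>
        (pmp_system \<xi> I \<gamma> l
          \<longleftrightarrow> (horizontal_curve I \<gamma> \<and> vertical_part \<xi> I l \<and> horizontal_part \<xi> I \<gamma> l))
        \<and>
        ((horizontal_curve I \<gamma> \<and> vertical_part \<xi> I l \<and> horizontal_part \<xi> I \<gamma> l)
          \<longleftrightarrow> (cov_const_momentum I \<gamma> l \<and>
               (\<forall>t\<in>I. metric_inv \<xi> (\<gamma> t) (proj_Delta \<gamma> l t) = velocity I \<gamma> t))))"
proof (intro conjI allI impI)
  fix I \<gamma>
  assume I: "nondeg_interval I"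
  show "(horizontal_curve I \<gamma> \<and> arclength_param \<xi> I \<gamma> \<and> exp_curve I \<gamma>)
      \<longleftrightarrow> (\<exists>g0\<in>SE3. \<exists>c :: nat \<Rightarrow> real. \<xi>^2 * (c 3)^2 + (c 4)^2 + (c 5)^2 = 1 \<and>
        (\<forall>t\<in>I. \<gamma> t = se_mult g0 (se_exp (t *\<^sub>R (\<Sum>i=3..5. c i *\<^sub>R frame i se_one)))))"
    by (rule horizontal_exp_curve_iff[OF I])
  show "(horizontal_curve I \<gamma> \<and> arclength_param \<xi> I \<gamma> \<and> exp_curve I \<gamma>)
      \<longleftrightarrow> (horizontal_curve I \<gamma> \<and> arclength_param \<xi> I \<gamma> \<and> auto_parallel I \<gamma>)"
    using horizontal_exp_curve_iff_auto_parallel[OF I] by blast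
next
  fix I \<gamma> l
  assume "pmp_system \<xi> I \<gamma> l"
  then show "cov_const_momentum I \<gamma> l" by (rule pmp_system_cov_const_momentum)
next
  fix I \<gamma>
  assume "\<forall>I \<gamma>. sr_geodesic \<xi> I \<gamma> \<and> arclength_param \<xi> I \<gamma> \<longrightarrow> (\<exists>l. pmp_system \<xi> I \<gamma> l)"
    and "sr_geodesic \<xi> I \<gamma> \<and> arclength_param \<xi> I \<gamma>"
  then show "\<exists>l. pmp_system \<xi> I \<gamma> l \<and> cov_const_momentum I \<gamma> l"
    using pmp_system_cov_const_momentum by blast
next
  fix I \<gamma> l
  assume curves: "SE3_curve I \<gamma> \<and> momentum_curve I l"
  then show "pmp_system \<xi> I \<gamma> l
      \<longleftrightarrow> (horizontal_curve I \<gamma> \<and> vertical_part \<xi> I l \<and> horizontal_part \<xi> I \<gamma> l)"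
    by (intro pmp_system_iff) simp_all
  have curve: "SE3_curve I \<gamma>" using curves by blast
  \<comment> \<open>The equation with the inverse metric is the vector equation of
    \<open>velocity_eq_contra_iff\<close>, so horizontality of the curve is contained in it.\<close>
  have "(\<forall>t\<in>I. metric_inv \<xi> (\<gamma> t) (proj_Delta \<gamma> l t) = velocity I \<gamma> t)
      \<longleftrightarrow> (\<forall>t\<in>I. velocity I \<gamma> t = (\<Sum>i=3..5. contra \<xi> l i t *\<^sub>R frame i (\<gamma> t)))"
    using curve assms by (intro ball_cong refl) (auto simp: metric_inv_proj_Delta SE3_curve_def)
  then show "(horizontal_curve I \<gamma> \<and> vertical_part \<xi> I l \<and> horizontal_part \<xi> I \<gamma> l)
      \<longleftrightarrow> (cov_const_momentum I \<gamma> l \<and>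
         (\<forall>t\<in>I. metric_inv \<xi> (\<gamma> t) (proj_Delta \<gamma> l t) = velocity I \<gamma> t))"
    using velocity_eq_contra_iff[OF curve, of \<xi> l] cov_const_momentum_iff_vertical_part[OF curve]
    by blast
qed

end
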